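(* Let $n\ge 6$ and fix six indices $s_1<\dots<s_6$ in $[n]=\{1,\dots,n\}$. For any two disjoint classes $[\sigma]$ and $[\sigma']$ there exists a unique class $[\sigma'']$, disjoint from both $[\sigma]$ and $[\sigma']$, such that $\{Q_{\sigma},Q_{\sigma'},Q_{\sigma''}\}$ is a Pappus configuration; that is, writing $\sigma_1=\sigma,\ \sigma_2=\sigma',\ \sigma_3=\sigma''$, one has $$Q_{\sigma_{i_1}}\cap Q_{\sigma_{i_2}}=\bigcap_{i=1}^{3}Q_{\sigma_i}$$ for every two-element subset $\{i_1,i_2\}\subset\{1,2,3\}$.
   Context: $Gr(3,\mathbb{C}^n)$ is the Grassmannian of $3$-dimensional subspaces of $\mathbb{C}^n$, embedded in $\mathbb{P}(\bigwedge^3\mathbb{C}^n)$ by the Plücker embedding, with Plücker coordinates $\beta_{ijl}$; these are extended to arbitrary ordered triples of indices by antisymmetry (for a subspace spanned by the rows of a $3\times n$ matrix with columns $\alpha_1,\dots,\alpha_n$, $\beta_{ijl}=\det(\alpha_i,\alpha_j,\alpha_l)$). Fix indices $s_1<\dots<s_6$ in $[n]$. For $\sigma\in\mathbf{S}_6$ put $i_j=s_{\sigma(j)}$. The class of $\sigma$ is the partition of $\{s_1,\dots,s_6\}$ into three unordered pairs $[\sigma]=\{\{i_1,i_2\},\{i_3,i_4\},\{i_5,i_6\}\}$ (there are 15 classes). The quadric $Q_\sigma\subset Gr(3,\mathbb{C}^n)$ is the set of points of $Gr(3,\mathbb{C}^n)$ satisfying $$\beta_{i_1i_3i_4}\beta_{i_2i_5i_6}-\beta_{i_2i_3i_4}\beta_{i_1i_5i_6}=0;$$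 as a subset of the Grassmannian it depends only on the class $[\sigma]$. Two classes are disjoint if they have no pair in common. A Pappus configuration is a set $\{Q_{\sigma_1},Q_{\sigma_2},Q_{\sigma_3}\}$ with $[\sigma_1],[\sigma_2],[\sigma_3]$ pairwise disjoint and $Q_{\sigma_{i_1}}\cap Q_{\sigma_{i_2}}=\bigcap_{i=1}^3Q_{\sigma_i}$ for every two-element subset $\{i_1,i_2\}\subset\{1,2,3\}$. *)

theory Defs
  imports "HOL-Analysis.Analysis" "HOL-Combinatorics.Permutations"
begin

text \<open>
  The index set $[n]$ is a finite linearly ordered type \<open>'n\<close> with \<open>n = CARD('n)\<close>.
  The operations prefixed with \<open>vec\<close> are those of the vector space \<open>complex ^ 'n\<close> over the
  complex numbers; the unprefixed \<open>subspace\<close>, \<open>span\<close> and \<open>dim\<close> would be the real ones.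
\<close>

definition Gr3 :: "(complex ^ 'n::finite) set set" where
  "Gr3 = {V. vec.subspace V \<and> vec.dim V = 3}"

definition plucker :: "complex ^ 'n ^ 3 \<Rightarrow> 'n::finite \<Rightarrow> 'n \<Rightarrow> 'n \<Rightarrow> complex" where
  "plucker A i j l =
     det (transpose (vector [column i A, column j A, column l A] :: complex ^ 3 ^ 3))"

text \<open>
  The vectors of homogeneous Plucker coordinates of a point \<open>V\<close> of the Grassmannian, on arbitrary
  ordered triples of indices. Changing the spanning matrix rescales the coordinates.
\<close>

definition plucker_coordinates ::
  "(complex ^ 'n::finite) set \<Rightarrow> ('n \<Rightarrow> 'n \<Rightarrow> 'n \<Rightarrow> complex) set" where
  "plucker_coordinates V = {plucker A | A. vec.span (rows A) = V}"

definition index_class :: "(nat \<Rightarrow> 'n) \<Rightarrow> (nat \<Rightarrow> nat) \<Rightarrow> 'n set set" where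
  "index_class s \<sigma> = {{s (\<sigma> 1), s (\<sigma> 2)}, {s (\<sigma> 3), s (\<sigma> 4)}, {s (\<sigma> 5), s (\<sigma> 6)}}"

definition quadric_eq :: "('n \<Rightarrow> 'n \<Rightarrow> 'n \<Rightarrow> complex) \<Rightarrow> (nat \<Rightarrow> 'n) \<Rightarrow> bool" where
  "quadric_eq \<beta> i \<longleftrightarrow>
     \<beta> (i 1) (i 3) (i 4) * \<beta> (i 2) (i 5) (i 6) - \<beta> (i 2) (i 3) (i 4) * \<beta> (i 1) (i 5) (i 6) = 0"

text \<open>
  The equation is homogeneous, so it may be tested on any one vector of Plucker coordinates of
  \<open>V\<close>; see \<open>quadric_iff\<close> and \<open>quadric_altdef\<close> below.
\<close>

definition quadric :: "(nat \<Rightarrow> 'n) \<Rightarrow> (nat \<Rightarrow> nat) \<Rightarrow> (complex ^ 'n::finite) set set" where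
  "quadric s \<sigma> = {V \<in> Gr3. \<forall>\<beta> \<in> plucker_coordinates V. quadric_eq \<beta> (\<lambda>j. s (\<sigma> j))}"

definition pappus_configuration ::
  "(nat \<Rightarrow> 'n::finite) \<Rightarrow> (nat \<Rightarrow> nat) \<Rightarrow> (nat \<Rightarrow> nat) \<Rightarrow> (nat \<Rightarrow> nat) \<Rightarrow> bool" where
  "pappus_configuration s \<sigma>1 \<sigma>2 \<sigma>3 \<longleftrightarrow>
     index_class s \<sigma>1 \<inter> index_class s \<sigma>2 = {} \<and>
     index_class s \<sigma>1 \<inter> index_class s \<sigma>3 = {} \<and>
     index_class s \<sigma>2 \<inter> index_class s \<sigma>3 = {} \<and>
     quadric s \<sigma>1 \<inter> quadric s \<sigma>2 = quadric s \<sigma>1 \<inter> quadric s \<sigma>2 \<inter> quadric s \<sigma>3 \<and>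
     quadric s \<sigma>1 \<inter> quadric s \<sigma>3 = quadric s \<sigma>1 \<inter> quadric s \<sigma>2 \<inter> quadric s \<sigma>3 \<and>
     quadric s \<sigma>2 \<inter> quadric s \<sigma>3 = quadric s \<sigma>1 \<inter> quadric s \<sigma>2 \<inter> quadric s \<sigma>3"

lemma plucker_matrix_mult: "plucker (M ** A) i j l = det M * plucker A i j l"
proof -
  have c: "column k (M ** A) = M *v column k A" for k
    by (simp add: column_def matrix_matrix_mult_def matrix_vector_mult_def vec_eq_iff)
  have "transpose (vector [column i (M ** A), column j (M ** A), column l (M ** A)] :: complex ^ 3 ^ 3)
      = M ** transpose (vector [column i A, column j A, column l A])"
    unfolding c by (simp add: vec_eq_iff transpose_def matrix_matrix_mult_def
        matrix_vector_mult_def forall_3 vector_3)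
  then show ?thesis by (simp add: plucker_def det_mul)
qed

lemma rows_subset_span_imp_mult:
  fixes A B :: "complex ^ 'n ^ 3"
  assumes "rows B \<subseteq> vec.span (rows A)"
  obtains M where "B = M ** A"
proof -
  have "\<exists>u. row r B = (\<Sum>k\<in>UNIV. u k *s row k A)" for r
  proof -
    have "row r B \<in> vec.span (range (\<lambda>k. row k A))"
      using assms by (auto simp: rows_def full_SetCompr_eq)
    then show ?thesis
    proof (induction rule: vec.span_induct_alt)
      case base
      then show ?case by (intro exI[of _ "\<lambda>_. 0"]) simp
    next
      case (step c x y)
      then obtain k u where xy: "x = row k A" "y = (\<Sum>k\<in>UNIV. u k *s row k A)" by auto
      have "(\<Sum>j\<in>UNIV. (if j = k then c else 0) *s row j A) = (\<Sum>j\<in>UNIV. if j = k then c *s row j A else 0)"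
        by (rule sum.cong) auto
      then have "c *s x + y = (\<Sum>j\<in>UNIV. ((if j = k then c else 0) + u j) *s row j A)"
        by (simp add: vec.scale_left_distrib sum.distrib xy)
      then show ?case by (rule exI[of _ "\<lambda>j. (if j = k then c else 0) + u j"])
    qed
  qed
  then obtain u where u: "\<And>r. row r B = (\<Sum>k\<in>UNIV. u r k *s row k A)" by metis
  have "B = (\<chi> r k. u r k) ** A"
    using u by (simp add: vec_eq_iff row_def matrix_matrix_mult_def)
  then show thesis by (rule that)
qed

lemma quadric_eq_matrix_cong:
  fixes A B :: "complex ^ 'n ^ 3"
  assumes "vec.span (rows B) = vec.span (rows A)"
  shows "quadric_eq (plucker B) i \<longleftrightarrow> quadric_eq (plucker A) i"
proof -
  have *: "quadric_eq (plucker D) i"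
    if eq: "quadric_eq (plucker C) i" and sp: "vec.span (rows D) = vec.span (rows C)" for C D :: "complex ^ 'n ^ 3"
  proof -
    obtain M where M: "D = M ** C"
      using rows_subset_span_imp_mult[of D C] vec.span_superset[of "rows D"] sp by auto
    have "plucker D (i 1) (i 3) (i 4) * plucker D (i 2) (i 5) (i 6)
        - plucker D (i 2) (i 3) (i 4) * plucker D (i 1) (i 5) (i 6) =
        det M * det M * (plucker C (i 1) (i 3) (i 4) * plucker C (i 2) (i 5) (i 6)
        - plucker C (i 2) (i 3) (i 4) * plucker C (i 1) (i 5) (i 6))"
      by (simp add: M plucker_matrix_mult algebra_simps)
    with eq show ?thesis by (simp add: quadric_eq_def)
  qed
  from *[of A B] *[of B A] assms show ?thesis by auto
qed

lemma Gr3_obtain_matrix: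
  assumes "V \<in> Gr3"
  obtains A :: "complex ^ 'n::finite ^ 3" where "vec.span (rows A) = V"
proof -
  obtain B where B: "B \<subseteq> V" "vec.independent B" "V \<subseteq> vec.span B" "card B = vec.dim V"
    using vec.basis_exists[of V] by blast
  have "card B = CARD(3)" using B(4) assms by (simp add: Gr3_def)
  moreover have "finite B" using B(2) by (rule vec.finiteI_independent)
  ultimately obtain f :: "3 \<Rightarrow> _" where f: "bij_betw f UNIV B"
    using finite_same_card_bij[of "UNIV :: 3 set" B] by auto
  have "rows (\<chi> k. f k) = B"
    using f by (auto simp: rows_def row_def bij_betw_def)
  moreover have "vec.span B = V"
    using vec.span_subspace[OF B(1,3)] assms by (simp add: Gr3_def)
  ultimately show thesis using that by metis
qed

lemma quadric_iff:
  assumes "vec.span (rows A) \<in> Gr3"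
  shows "vec.span (rows A) \<in> quadric s \<sigma> \<longleftrightarrow> quadric_eq (plucker A) (\<lambda>j. s (\<sigma> j))"
proof -
  have "(\<forall>\<beta> \<in> plucker_coordinates (vec.span (rows A)). quadric_eq \<beta> (\<lambda>j. s (\<sigma> j))) \<longleftrightarrow>
      quadric_eq (plucker A) (\<lambda>j. s (\<sigma> j))"
    unfolding plucker_coordinates_def using quadric_eq_matrix_cong[of _ A] by blast
  then show ?thesis using assms by (simp add: quadric_def)
qed

lemma quadric_altdef:
  fixes s :: "nat \<Rightarrow> 'n::finite"
  shows "quadric s \<sigma> = {V \<in> Gr3. \<exists>\<beta> \<in> plucker_coordinates V. quadric_eq \<beta> (\<lambda>j. s (\<sigma> j))}"
proof (rule set_eqI)
  fix V
  show "V \<in> quadric s \<sigma> \<longleftrightarrow>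
    V \<in> {V \<in> Gr3. \<exists>\<beta> \<in> plucker_coordinates V. quadric_eq \<beta> (\<lambda>j. s (\<sigma> j))}"
  proof (cases "V \<in> Gr3")
    case True
    then obtain A :: "complex ^ 'n ^ 3" where A: "vec.span (rows A) = V" by (rule Gr3_obtain_matrix)
    have "(\<exists>\<beta> \<in> plucker_coordinates V. quadric_eq \<beta> (\<lambda>j. s (\<sigma> j))) \<longleftrightarrow>
        quadric_eq (plucker A) (\<lambda>j. s (\<sigma> j))"
      unfolding plucker_coordinates_def using quadric_eq_matrix_cong[of _ A] A by blast
    with True A quadric_iff[of A s \<sigma>] show ?thesis by simp
  qed (simp add: quadric_def)
qed

lemma quadric_eq_swaps:
  fixes A :: "complex ^ 'n ^ 3"
  defines "E \<equiv> \<lambda>a b c d e f. plucker A a c d * plucker A b e f - plucker A b c d * plucker A a e f = 0"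
  shows "E b a c d e f = E a b c d e f" "E a b d c e f = E a b c d e f" "E a b c d f e = E a b c d e f"
    "E a b e f c d = E a b c d e f" "E c d a b e f = E a b c d e f"
proof -
  note d = E_def plucker_def det_3 transpose_def column_def
  show "E b a c d e f = E a b c d e f" "E a b e f c d = E a b c d e f"
    unfolding E_def by (simp_all add: algebra_simps eq_commute)
  show "E a b d c e f = E a b c d e f" "E a b c d f e = E a b c d e f" "E c d a b e f = E a b c d e f"
    unfolding d by (simp_all; algebra)+
qed

lemma pairs_cong:
  assumes sw: "\<And>a b c d e f. E b a c d e f = E a b c d e f" "\<And>a b c d e f. E a b d c e f = E a b c d e f"
    "\<And>a b c d e f. E a b c d f e = E a b c d e f" "\<And>a b c d e f. E a b e f c d = E a b c d e f"
    "\<And>a b c d e f. E c d a b e f = E a b c d e f"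
    and "distinct [a, b, c, d, e, f]"
    and eq: "{{a, b}, {c, d}, {e, f}} = {{a', b'}, {c', d'}, {e', f'}}"
  shows "E a' b' c' d' e' f' = E a b c d e f"
proof -
  have "{a, b} \<in> {{a', b'}, {c', d'}, {e', f'}}" "{c, d} \<in> {{a', b'}, {c', d'}, {e', f'}}"
    "{e, f} \<in> {{a', b'}, {c', d'}, {e', f'}}" "{a, b} \<noteq> {c, d}" "{a, b} \<noteq> {e, f}" "{c, d} \<noteq> {e, f}"
    using assms(6) by (auto simp flip: eq simp: doubleton_eq_iff)
  then show ?thesis
    apply (simp only: insert_iff empty_iff simp_thms)
    apply (elim disjE)
    apply (simp_all only: simp_thms)
    apply (simp_all only: doubleton_eq_iff)
    apply (elim disjE conjE; hypsubst; simp only: sw)+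
    done
qed

lemma quadric_class_cong:
  assumes "inj_on s {1..6}" "\<sigma> permutes {1..6}" "index_class s \<sigma> = index_class s \<tau>"
  shows "quadric s \<sigma> = quadric s \<tau>"
proof -
  have "inj_on (\<lambda>j. s (\<sigma> j)) {1..6}"
    using comp_inj_on[of \<sigma> "{1..6}" s] assms(1,2) by (simp add: permutes_inj_on permutes_image o_def)
  then have d: "distinct [s (\<sigma> 1), s (\<sigma> 2), s (\<sigma> 3), s (\<sigma> 4), s (\<sigma> 5), s (\<sigma> 6)]"
    by (auto dest!: inj_onD)
  have "quadric_eq (plucker A) (\<lambda>j. s (\<tau> j)) = quadric_eq (plucker A) (\<lambda>j. s (\<sigma> j))" for A
    unfolding quadric_eq_def
    by (rule pairs_cong[OF quadric_eq_swaps d assms(3)[unfolded index_class_def]])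
  then show ?thesis by (auto simp: quadric_def plucker_coordinates_def)
qed

end

theory Submission
  imports Defs
begin

text \<open>
  A column of the matrix is a point of the projective plane, and \<open>Q\<^sub>\<sigma>\<close> says that the three lines
  through the pairs of \<open>[\<sigma>]\<close> are concurrent. Two disjoint classes form a hexagon \<open>abcdef\<close>, with the
  pairs \<open>ab, cd, ef\<close> and \<open>bc, de, fa\<close>. The quadratic form of its long diagonals \<open>ad, be, cf\<close> is the
  difference of the other two forms, so any two of the three quadrics meet inside the third. Only three
  other classes are disjoint from both given ones, and a single explicit configuration of six
  points lies on the two given quadrics but on none of the three remaining ones.
\<close>

section \<open>Perfect matchings of a six-element set\<close>

definition perfect_matching :: "'a set \<Rightarrow> 'a set set \<Rightarrow> bool" where
  "perfect_matching S C \<longleftrightarrow> partition_on S C \<and> (\<forall>p\<in>C. card p = 2)"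

lemma perfect_matching_empty [simp]: "perfect_matching {} C \<longleftrightarrow> C = {}"
  by (auto simp: perfect_matching_def partition_on_def)

text \<open>The block through \<open>x\<close> is a pair, and deleting it leaves a matching of the
  other points. Used as a rewrite rule, this recursion enumerates the matchings of an explicit
  finite set.\<close>

lemma perfect_matching_insert:
  assumes "x \<notin> S"
  shows "perfect_matching (insert x S) C \<longleftrightarrow>
    (\<exists>y\<in>S. \<exists>C'. C = insert {x, y} C' \<and> perfect_matching (S - {y}) C')"
proof
  assume C: "perfect_matching (insert x S) C"
  then obtain p where p: "p \<in> C" "x \<in> p"
    by (auto simp: perfect_matching_def partition_on_def)
  then obtain y where y: "p = {x, y}" "y \<noteq> x"
    using C by (fastforce simp: perfect_matching_def card_2_iff)
  have "p \<subseteq> insert x S" using C p by (auto simp: perfect_matching_def partition_on_def)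
  then have "y \<in> S" using y by auto
  moreover have "C = insert {x, y} (C - {p})" using p y by auto
  moreover have "perfect_matching (S - {y}) (C - {p})"
  proof -
    have "disjnt p (\<Union> (C - {p}))"
      using C p unfolding perfect_matching_def partition_on_def disjoint_def disjnt_def by blast
    then have "partition_on (insert x S - p) (C - {p})"
      using C p partition_on_insert[of p "C - {p}" "insert x S"]
      by (simp add: perfect_matching_def insert_absorb)
    moreover have "insert x S - p = S - {y}" using y assms by auto
    ultimately show ?thesis using C by (simp add: perfect_matching_def)
  qed
  ultimately show "\<exists>y\<in>S. \<exists>C'. C = insert {x, y} C' \<and> perfect_matching (S - {y}) C'" by blast
next
  assume "\<exists>y\<in>S. \<exists>C'. C = insert {x, y} C' \<and> perfect_matching (S - {y}) C'"
  then obtain y C' where y: "y \<in> S" "C = insert {x, y} C'" "perfect_matching (S - {y}) C'" by blast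
  have "disjnt {x, y} (\<Union> C')"
    using y(3) assms by (auto simp: perfect_matching_def partition_on_def disjnt_def)
  moreover have "insert x S - {x, y} = S - {y}" using assms by auto
  ultimately have "partition_on (insert x S) C"
    using y partition_on_insert[of "{x, y}" C' "insert x S"] by (simp add: perfect_matching_def)
  moreover have "card {x, y} = 2" using y(1) assms by (cases "x = y") auto
  ultimately show "perfect_matching (insert x S) C" using y by (simp add: perfect_matching_def)
qed

lemma perfect_matching_doubletons:
  assumes "distinct [a, b, c, d, e, f]"
  shows "perfect_matching {a, b, c, d, e, f} {{a, b}, {c, d}, {e, f}}"
proof -
  have "\<exists>C'. {{a, b}, {c, d}, {e, f}} = insert {a, b} C' \<and> perfect_matching {c, d, e, f} C'"
    by (rule exI[of _ "{{c, d}, {e, f}}"]) (use assms in \<open>auto simp: perfect_matching_insert\<close>)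
  then show ?thesis using assms by (simp add: perfect_matching_insert)
qed

text \<open>The recursion offers five partners for \<open>a\<close>, then three for the next free
  point, then one: 5 * 3 * 1 = 15 matchings.\<close>

lemma perfect_matching_6:
  assumes "distinct [a, b, c, d, e, f]"
  shows "perfect_matching {a, b, c, d, e, f} C \<longleftrightarrow>
    C \<in> {{{a, b}, {c, d}, {e, f}}, {{a, b}, {c, e}, {d, f}},
    {{a, b}, {c, f}, {d, e}}, {{a, c}, {b, d}, {e, f}},
    {{a, c}, {b, e}, {d, f}}, {{a, c}, {b, f}, {d, e}},
    {{a, d}, {b, c}, {e, f}}, {{a, d}, {b, e}, {c, f}},
    {{a, d}, {b, f}, {c, e}}, {{a, e}, {b, c}, {d, f}},
    {{a, e}, {b, d}, {c, f}}, {{a, e}, {b, f}, {c, d}},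
    {{a, f}, {b, c}, {d, e}}, {{a, f}, {b, d}, {c, e}},
    {{a, f}, {b, e}, {c, d}}}"
proof -
  have ne: "a \<noteq> b" "a \<noteq> c" "a \<noteq> d" "a \<noteq> e" "a \<noteq> f" "b \<noteq> c" "b \<noteq> d" "b \<noteq> e" "b \<noteq> f"
    "c \<noteq> d" "c \<noteq> e" "c \<noteq> f" "d \<noteq> e" "d \<noteq> f" "e \<noteq> f"
    using assms by auto
  show ?thesis
    by (simp add: perfect_matching_insert insert_Diff_if disj_assoc conj_disj_distribL ex_disj_distrib
      ne ne[symmetric])
qed

text \<open>By inclusion-exclusion over the three forbidden pairs, 15 - 3 * 3 + 3 - 1 = 8 matchings
  survive.\<close>

lemma matchings_disjoint:
  assumes "distinct [a, b, c, d, e, f]"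
    and "perfect_matching {a, b, c, d, e, f} D"
    and "{{a, b}, {c, d}, {e, f}} \<inter> D = {}"
  shows "D \<in> {{{a, c}, {b, e}, {d, f}}, {{a, c}, {b, f}, {d, e}},
    {{a, d}, {b, e}, {c, f}}, {{a, d}, {b, f}, {c, e}},
    {{a, e}, {b, c}, {d, f}}, {{a, e}, {b, d}, {c, f}},
    {{a, f}, {b, c}, {d, e}}, {{a, f}, {b, d}, {c, e}}}"
proof -
  have "{a, b} \<notin> D" "{c, d} \<notin> D" "{e, f} \<notin> D"
    using assms(3) by auto
  then show ?thesis
    using assms(2) unfolding perfect_matching_6[OF assms(1)] by (elim insertE emptyE) simp_all
qed

text \<open>The union of two disjoint perfect matchings is a 2-regular graph whose cycles alternate
  between them and so have even length at least 4. On six points only a single 6-cycle is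
  possible.\<close>

lemma disjoint_matchings_hexagon:
  assumes d: "distinct [a', b', c', d', e', f']"
    and C: "C = {{a', b'}, {c', d'}, {e', f'}}"
    and D: "perfect_matching {a', b', c', d', e', f'} D"
    and disj: "C \<inter> D = {}"
  obtains a b c d e f where "distinct [a, b, c, d, e, f]"
    "{a, b, c, d, e, f} = {a', b', c', d', e', f'}"
    "C = {{a, b}, {c, d}, {e, f}}" "D = {{b, c}, {d, e}, {f, a}}"
proof -
  note hexagon = that
  \<comment> \<open>The hexagon is walked from \<open>a'\<close> to \<open>b'\<close> and onward:
    \<open>p\<close> is the partner of \<open>b'\<close> in \<open>D\<close>, \<open>q\<close> that
    of \<open>p\<close> in \<open>C\<close>, \<open>r\<close> that of \<open>q\<close> in
    \<open>D\<close>, \<open>t\<close> that of \<open>r\<close> in \<open>C\<close>. The eight cases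
    below only supply these values.\<close>
  have *: thesis if "distinct [a', b', p, q, r, t]" "{{p, q}, {r, t}} = {{c', d'}, {e', f'}}"
    "{p, q, r, t} = {c', d', e', f'}" "D = {{b', p}, {q, r}, {t, a'}}" for p q r t
    by (rule hexagon[of a' b' p q r t]) (use that C in simp_all)
  have "D \<in> {{{a', c'}, {b', e'}, {d', f'}}, {{a', c'}, {b', f'}, {d', e'}},
    {{a', d'}, {b', e'}, {c', f'}}, {{a', d'}, {b', f'}, {c', e'}},
    {{a', e'}, {b', c'}, {d', f'}}, {{a', e'}, {b', d'}, {c', f'}},
    {{a', f'}, {b', c'}, {d', e'}}, {{a', f'}, {b', d'}, {c', e'}}}"
    by (rule matchings_disjoint[OF d D]) (use disj C in simp)
  then show thesis
    apply (elim insertE emptyE)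
    subgoal by (rule *[of e' f' d' c']) (use d in \<open>auto simp: insert_commute\<close>)
    subgoal by (rule *[of f' e' d' c']) (use d in \<open>auto simp: insert_commute\<close>)
    subgoal by (rule *[of e' f' c' d']) (use d in \<open>auto simp: insert_commute\<close>)
    subgoal by (rule *[of f' e' c' d']) (use d in \<open>auto simp: insert_commute\<close>)
    subgoal by (rule *[of c' d' f' e']) (use d in \<open>auto simp: insert_commute\<close>)
    subgoal by (rule *[of d' c' f' e']) (use d in \<open>auto simp: insert_commute\<close>)
    subgoal by (rule *[of c' d' e' f']) (use d in \<open>auto simp: insert_commute\<close>)
    subgoal by (rule *[of d' c' e' f']) (use d in \<open>auto simp: insert_commute\<close>)
    done
qed

text \<open>Without its sides, the complete graph on the hexagon is a triangular prism, which has
  four perfect matchings: the three long diagonals, or one long diagonal with the two short ones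
  that it crosses at right angles in a regular hexagon.\<close>

lemma matchings_disjoint_from_hexagon:
  assumes "distinct [a, b, c, d, e, f]"
    and "perfect_matching {a, b, c, d, e, f} D"
    and "D \<inter> {{a, b}, {c, d}, {e, f}} = {}" "D \<inter> {{b, c}, {d, e}, {f, a}} = {}"
  shows "D \<in> {{{a, c}, {b, e}, {d, f}}, {{a, d}, {b, e}, {c, f}},
    {{a, d}, {b, f}, {c, e}}, {{a, e}, {b, d}, {c, f}}}"
proof -
  have "D \<in> {{{a, c}, {b, e}, {d, f}}, {{a, c}, {b, f}, {d, e}},
    {{a, d}, {b, e}, {c, f}}, {{a, d}, {b, f}, {c, e}},
    {{a, e}, {b, c}, {d, f}}, {{a, e}, {b, d}, {c, f}},
    {{a, f}, {b, c}, {d, e}}, {{a, f}, {b, d}, {c, e}}}"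
    by (rule matchings_disjoint[OF assms(1,2)]) (use assms(3) in auto)
  moreover have "{b, c} \<notin> D" "{d, e} \<notin> D" "{a, f} \<notin> D"
    using assms(4) by (auto simp: insert_commute)
  ultimately show ?thesis by (elim insertE emptyE) simp_all
qed

section \<open>Matchings as classes of permutations\<close>

lemma distinct_index:
  fixes s :: "nat \<Rightarrow> 'n"
  assumes "inj_on s {1..6}" "\<sigma> permutes {1..6}"
  shows "distinct [s (\<sigma> 1), s (\<sigma> 2), s (\<sigma> 3), s (\<sigma> 4), s (\<sigma> 5), s (\<sigma> 6)]"
proof -
  have "inj_on (\<lambda>j. s (\<sigma> j)) {1..6}"
    using comp_inj_on[of \<sigma> "{1..6}" s] assms by (simp add: permutes_inj_on permutes_image o_def)
  then show ?thesis by (auto dest!: inj_onD)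
qed

lemma index_image:
  fixes s :: "nat \<Rightarrow> 'n"
  assumes "\<sigma> permutes {1..6}"
  shows "{s (\<sigma> 1), s (\<sigma> 2), s (\<sigma> 3), s (\<sigma> 4), s (\<sigma> 5), s (\<sigma> 6)} = s ` {1..6}"
proof -
  have six: "{1..6} = {1, 2, 3, 4, 5, 6::nat}" by auto
  have "s ` {1..6} = s ` \<sigma> ` {1..6}" using assms by (simp add: permutes_image)
  then show ?thesis by (simp only: six image_insert image_empty)
qed

lemma perfect_matching_index_class:
  assumes "inj_on s {1..6}" "\<sigma> permutes {1..6}"
  shows "perfect_matching (s ` {1..6}) (index_class s \<sigma>)"
  using perfect_matching_doubletons[OF distinct_index[OF assms]]
  by (simp only: index_image[OF assms(2)] index_class_def)

lemma index_class_surj: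
  fixes s :: "nat \<Rightarrow> 'n"
  assumes s: "inj_on s {1..6}" and d: "distinct [a, b, c, d, e, f]"
    and img: "{a, b, c, d, e, f} = s ` {1..6}"
  obtains \<sigma> where "\<sigma> permutes {1..6}" "index_class s \<sigma> = {{a, b}, {c, d}, {e, f}}"
proof -
  \<comment> \<open>\<open>g\<close> lists the six points at positions 1 to 6; the shift by one is
    there because \<open>!\<close> counts from 0. Pulling \<open>g\<close> back along
    \<open>s\<close> gives the permutation, extended by the identity as \<open>permutes\<close>
    demands.\<close>
  define g :: "nat \<Rightarrow> 'n" where "g = (\<lambda>j. [a, b, c, d, e, f] ! (j - 1))"
  define \<sigma> where "\<sigma> = (\<lambda>j. if j \<in> {1..6} then inv_into {1..6} s (g j) else j)"
  have six: "{1..6} = {1, 2, 3, 4, 5, 6::nat}" by auto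
  have gimg: "g ` {1..6} = s ` {1..6}" unfolding img[symmetric] unfolding six by (simp add: g_def)
  have "inj_on g {1..6}" unfolding six using d by (auto simp: g_def inj_on_def)
  then have "bij_betw g {1..6} (s ` {1..6})" using gimg by (simp add: bij_betw_def)
  moreover have "bij_betw (inv_into {1..6} s) (s ` {1..6}) {1..6}"
    using s by (simp add: bij_betw_inv_into inj_on_imp_bij_betw)
  ultimately have "bij_betw (inv_into {1..6} s \<circ> g) {1..6} {1..6}" by (rule bij_betw_trans)
  then have "bij_betw \<sigma> {1..6} {1..6}"
    by (subst bij_betw_cong[of _ _ "inv_into {1..6} s \<circ> g"]) (auto simp: \<sigma>_def)
  then have "\<sigma> permutes {1..6}" by (rule bij_imp_permutes) (simp only: \<sigma>_def if_False)
  moreover have "s (\<sigma> j) = g j" if "j \<in> {1..6}" for j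
  proof -
    have "g j \<in> s ` {1..6}" using that gimg by blast
    then show ?thesis using that f_inv_into_f by (simp add: \<sigma>_def)
  qed
  then have "index_class s \<sigma> = {{a, b}, {c, d}, {e, f}}" by (simp add: index_class_def g_def)
  ultimately show thesis by (rule that)
qed

section \<open>Concurrency of three lines\<close>

text \<open>For columns x_a, ..., x_f the form is det(x_a \<times> x_b, x_c \<times> x_d, x_e
  \<times> x_f), the determinant of the three lines. Naming the six points directly lets the hexagon
  be relabelled without building permutations.\<close>

definition concurrent :: "'n \<Rightarrow> 'n \<Rightarrow> 'n \<Rightarrow> 'n \<Rightarrow> 'n \<Rightarrow> 'n \<Rightarrow> (complex ^ 'n::finite) set set" where
  "concurrent a b c d e f = {V \<in> Gr3. \<forall>\<beta> \<in> plucker_coordinates V.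
     \<beta> a c d * \<beta> b e f - \<beta> b c d * \<beta> a e f = 0}"

lemma concurrent_span_rows_iff:
  assumes "vec.span (rows A) \<in> Gr3"
  shows "vec.span (rows A) \<in> concurrent a b c d e f \<longleftrightarrow>
    plucker A a c d * plucker A b e f - plucker A b c d * plucker A a e f = 0"
proof -
  \<comment> \<open>With the six labels as index map and \<open>id\<close> as permutation,
    \<open>quadric_iff\<close> applies to arbitrary labels, even repeated ones.\<close>
  define i :: "nat \<Rightarrow> 'a" where "i = (\<lambda>j. [a, b, c, d, e, f] ! (j - 1))"
  have "concurrent a b c d e f = quadric i id"
    by (simp add: concurrent_def quadric_def quadric_eq_def i_def)
  then show ?thesis
    using quadric_iff[OF assms, of i id] by (simp add: quadric_eq_def i_def)
qed

text \<open>A polynomial identity in the 18 entries of six columns, checked by expansion.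
  Geometrically it yields the dual of the Pappus theorem: if the sides of a hexagon pass alternately
  through two points, its long diagonals are concurrent.\<close>

lemma concurrent_linear_relation:
  fixes A :: "complex ^ 'n::finite ^ 3"
  defines "E \<equiv> \<lambda>a b c d e f. plucker A a c d * plucker A b e f - plucker A b c d * plucker A a e f"
  shows "E b c d e f a = E a b c d e f + E a d b e c f"
  unfolding E_def plucker_def det_3 by (simp add: transpose_def column_def) algebra

text \<open>Projection to the coordinates \<open>i\<close>, \<open>j\<close>, \<open>l\<close> is
  linear and sends the rows of \<open>A\<close> to the independent rows of an invertible minor, so
  the dimension is at least 3; three rows span no more.\<close>

lemma span_rows_in_Gr3:
  fixes A :: "complex ^ 'n::finite ^ 3"
  assumes "plucker A i j l \<noteq> 0"
  shows "vec.span (rows A) \<in> Gr3"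
proof -
  define M :: "complex ^ 3 ^ 3" where "M = transpose (vector [column i A, column j A, column l A])"
  define p :: "complex ^ 'n \<Rightarrow> complex ^ 3" where "p = (\<lambda>x. vector [x $ i, x $ j, x $ l])"
  \<comment> \<open>\<open>rows M\<close> is a set, so coinciding rows would be counted once; the
    nonzero determinant excludes this.\<close>
  have "inj (\<lambda>k. row k M)"
  proof (rule injI, rule ccontr)
    fix k k' assume "row k M = row k' M" "k \<noteq> k'"
    then have "det M = 0" using det_identical_rows by blast
    with assms show False by (simp add: plucker_def M_def)
  qed
  then have "card (rows M) = 3"
    by (simp add: rows_def full_SetCompr_eq card_image)
  moreover have "vec.independent (rows M)"
    using det_dependent_rows[of M] assms by (auto simp: plucker_def M_def)
  ultimately have "3 = vec.dim (rows M)"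
    by (simp add: vec.dim_eq_card_independent)
  also have "rows M = p ` rows A"
    by (auto simp: rows_def p_def M_def row_def transpose_def column_def vec_eq_iff forall_3 image_def)
  also have "vec.dim (p ` rows A) \<le> vec.dim (rows A)"
    by (rule vec.dim_image_le) (unfold_locales, auto simp: p_def vec_eq_iff forall_3)
  finally have "3 \<le> vec.dim (rows A)" .
  moreover have "vec.dim (rows A) \<le> card (rows A)"
    by (rule vec.dim_le_card') (simp add: rows_def full_SetCompr_eq)
  moreover have "card (rows A) \<le> 3"
    using card_image_le[of "UNIV :: 3 set" "\<lambda>i. row i A"]
    by (simp add: rows_def full_SetCompr_eq)
  ultimately show ?thesis by (simp add: Gr3_def)
qed

text \<open>Reordering the pairs, or the points within a pair, changes the form at most by a sign,
  so the labelling of the hexagon may replace that given by \<open>\<sigma>\<close>.\<close>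

lemma quadric_eq_concurrent:
  assumes "inj_on s {1..6}" "\<sigma> permutes {1..6}" "index_class s \<sigma> = {{a, b}, {c, d}, {e, f}}"
  shows "quadric s \<sigma> = concurrent a b c d e f"
proof -
  have "quadric_eq (plucker A) (\<lambda>j. s (\<sigma> j)) \<longleftrightarrow>
      plucker A a c d * plucker A b e f - plucker A b c d * plucker A a e f = 0" for A
    unfolding quadric_eq_def
    by (rule pairs_cong[OF quadric_eq_swaps distinct_index[OF assms(1,2)]
          assms(3)[unfolded index_class_def], symmetric])
  then show ?thesis by (auto simp: quadric_def concurrent_def plucker_coordinates_def)
qed

lemma concurrent_inter:
  fixes a b c d e f :: "'n::finite"
  defines "P \<equiv> concurrent a b c d e f" and "Q \<equiv> concurrent b c d e f a"
    and "R \<equiv> concurrent a d b e c f"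
  shows "P \<inter> Q \<subseteq> R" "P \<inter> R \<subseteq> Q" "Q \<inter> R \<subseteq> P"
proof -
  have "(V \<in> P \<inter> Q \<longrightarrow> V \<in> R) \<and> (V \<in> P \<inter> R \<longrightarrow> V \<in> Q) \<and> (V \<in> Q \<inter> R \<longrightarrow> V \<in> P)" for V
  proof (cases "V \<in> Gr3")
    case True
    then obtain A :: "complex ^ 'n ^ 3" where A: "vec.span (rows A) = V" by (rule Gr3_obtain_matrix)
    have *: "(x = 0 \<and> y = 0 \<longrightarrow> z = 0) \<and> (x = 0 \<and> z = 0 \<longrightarrow> y = 0) \<and> (y = 0 \<and> z = 0 \<longrightarrow> x = 0)"
      if "y = x + z" for x y z :: complex
      using that by auto
    show ?thesis
      using True unfolding A[symmetric] P_def Q_def R_def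
      by (simp only: concurrent_span_rows_iff Int_iff) (rule *, rule concurrent_linear_relation)
  qed (simp add: P_def Q_def R_def concurrent_def)
  then show "P \<inter> Q \<subseteq> R" "P \<inter> R \<subseteq> Q" "Q \<inter> R \<subseteq> P" by blast+
qed

lemma hexagon_witness:
  fixes a b c d e f :: "'n::finite"
  assumes "distinct [a, b, c, d, e, f]"
  obtains V where "V \<in> concurrent a b c d e f" "V \<in> concurrent b c d e f a"
    "V \<notin> concurrent a c b e d f" "V \<notin> concurrent a d b f c e" "V \<notin> concurrent a e b d c f"
proof -
  \<comment> \<open>\<open>a\<close>, \<open>c\<close>, \<open>e\<close> form the coordinate
    triangle, and b = c + e, d = a + c, f = a + e lie on its sides. Hence ab, cd, ef all pass
    through \<open>a\<close>, and bc, de, fa all through \<open>e\<close>. Columns of other indices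
    are 0.\<close>
  define g :: "'n \<Rightarrow> complex ^ 3" where "g = (\<lambda>_. 0)(a := vector [1, 0, 0], b := vector [0, 1, 1],
    c := vector [0, 1, 0], d := vector [1, 1, 0], e := vector [0, 0, 1], f := vector [1, 0, 1])"
  define A :: "complex ^ 'n ^ 3" where "A = (\<chi> i j. g j $ i)"
  have g: "g a = vector [1, 0, 0]" "g b = vector [0, 1, 1]" "g c = vector [0, 1, 0]"
    "g d = vector [1, 1, 0]" "g e = vector [0, 0, 1]" "g f = vector [1, 0, 1]"
    using assms by (auto simp: g_def)
  have pl: "plucker A i j l = det (transpose (vector [g i, g j, g l]))" for i j l
    by (simp add: plucker_def A_def column_def)
  have "plucker A a c e \<noteq> 0" by (simp add: pl g det_3 transpose_def)
  then have "vec.span (rows A) \<in> Gr3" by (rule span_rows_in_Gr3)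
  note * = concurrent_span_rows_iff[OF this]
  show thesis
    by (rule that[of "vec.span (rows A)"]) (simp_all add: * pl g det_3 transpose_def)
qed

section \<open>Existence and uniqueness of the third class\<close>

theorem theorem5p3:
  fixes s :: "nat \<Rightarrow> 'n::{finite,linorder}"
    and \<sigma> \<sigma>' :: "nat \<Rightarrow> nat"
  assumes "CARD('n) \<ge> 6"
    and "strict_mono_on {1..6} s"
    and "\<sigma> permutes {1..6}"
    and "\<sigma>' permutes {1..6}"
    and "index_class s \<sigma> \<inter> index_class s \<sigma>' = {}"
  shows "\<exists>!C. \<exists>\<sigma>''. \<sigma>'' permutes {1..6} \<and> C = index_class s \<sigma>'' \<and>
    C \<inter> index_class s \<sigma> = {} \<and> C \<inter> index_class s \<sigma>' = {} \<and>
    pappus_configuration s \<sigma> \<sigma>' \<sigma>''"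
proof -
  have s: "inj_on s {1..6}" using assms(2) by (rule strict_mono_on_imp_inj_on)
  note img = index_image[OF assms(3), of s]
  obtain a b c d e f where dist: "distinct [a, b, c, d, e, f]"
    and S: "{a, b, c, d, e, f} = s ` {1..6}"
    and C1: "index_class s \<sigma> = {{a, b}, {c, d}, {e, f}}"
    and C2: "index_class s \<sigma>' = {{b, c}, {d, e}, {f, a}}"
    using disjoint_matchings_hexagon[OF distinct_index[OF s assms(3)] index_class_def _ assms(5)]
      perfect_matching_index_class[OF s assms(4)] unfolding img by metis
  note Q1 = quadric_eq_concurrent[OF s assms(3) C1] and Q2 = quadric_eq_concurrent[OF s assms(4) C2]
  have "{a, d, b, e, c, f} = s ` {1..6}" using S by (simp add: insert_commute)
  moreover have "distinct [a, d, b, e, c, f]" using dist by auto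
  \<comment> \<open>The third class consists of the long diagonals of the hexagon.\<close>
  ultimately obtain \<tau> where \<tau>: "\<tau> permutes {1..6}"
    and C3: "index_class s \<tau> = {{a, d}, {b, e}, {c, f}}"
    using index_class_surj[OF s] by metis
  note Q3 = quadric_eq_concurrent[OF s \<tau> C3]
  have disj: "index_class s \<tau> \<inter> index_class s \<sigma> = {}" "index_class s \<tau> \<inter> index_class s \<sigma>' = {}"
    unfolding C1 C2 C3 using dist by (auto simp: doubleton_eq_iff)
  have pappus: "pappus_configuration s \<sigma> \<sigma>' \<tau>"
  proof -
    note inter = concurrent_inter[where a = a and b = b and c = c and d = d and e = e and f = f]
    show ?thesis
      unfolding pappus_configuration_def Q1 Q2 Q3
    proof (intro conjI)
      show "index_class s \<sigma> \<inter> index_class s \<sigma>' = {}" by (rule assms(5))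
      show "index_class s \<sigma> \<inter> index_class s \<tau> = {}" "index_class s \<sigma>' \<inter> index_class s \<tau> = {}"
        using disj by (simp_all add: Int_commute)
    qed (use inter in blast)+
  qed
  have uniq: "index_class s \<rho> = index_class s \<tau>"
    if \<rho>: "\<rho> permutes {1..6}" and "index_class s \<rho> \<inter> index_class s \<sigma> = {}"
      "index_class s \<rho> \<inter> index_class s \<sigma>' = {}" and p: "pappus_configuration s \<sigma> \<sigma>' \<rho>" for \<rho>
  proof (rule ccontr)
    assume ne: "index_class s \<rho> \<noteq> index_class s \<tau>"
    obtain V where V: "V \<in> concurrent a b c d e f" "V \<in> concurrent b c d e f a"
      and nV: "V \<notin> concurrent a c b e d f" "V \<notin> concurrent a d b f c e" "V \<notin> concurrent a e b d c f"
      by (rule hexagon_witness[OF dist])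
    \<comment> \<open>A Pappus configuration forces the intersection of the two given quadrics,
      which contains \<open>V\<close>, into the third one.\<close>
    have "V \<in> quadric s \<rho>"
      using p V unfolding pappus_configuration_def Q1 Q2 by blast
    moreover have "index_class s \<rho> \<in> {{{a, c}, {b, e}, {d, f}}, {{a, d}, {b, e}, {c, f}},
        {{a, d}, {b, f}, {c, e}}, {{a, e}, {b, d}, {c, f}}}"
      by (rule matchings_disjoint_from_hexagon[OF dist])
        (use perfect_matching_index_class[OF s \<rho>] that(2,3) in \<open>simp_all only: S C1 C2\<close>)
    \<comment> \<open>Of the four candidates, \<open>ne\<close> excludes the long diagonals, and
      \<open>V\<close> lies on none of the other three quadrics.\<close>
    ultimately show False
      using ne nV unfolding C3 by (elim insertE emptyE) (simp_all add: quadric_eq_concurrent[OF s \<rho>])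
  qed
  show ?thesis
  proof (intro ex1I[of _ "index_class s \<tau>"] exI[of _ \<tau>] conjI \<tau> disj pappus refl)
    fix C assume "\<exists>\<rho>. \<rho> permutes {1..6} \<and> C = index_class s \<rho> \<and>
      C \<inter> index_class s \<sigma> = {} \<and> C \<inter> index_class s \<sigma>' = {} \<and> pappus_configuration s \<sigma> \<sigma>' \<rho>"
    then show "C = index_class s \<tau>" by (elim exE conjE) (hypsubst, rule uniq)
  qed
qed

end
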